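(* Let $\alpha\in(0,1/2]$. If $\mathcal{T}$ is an $\alpha$-tree on a measure space $(X,\mu)$, then for any $\varepsilon>0$, any $\varphi\in\mathrm{BMO}(\mathcal{T})$ with $\|\varphi\|_{\mathrm{BMO}(\mathcal{T})}\le\varepsilon$, and any $J\in\mathcal{T}$, $$ \frac{\sqrt\alpha}{(1+\alpha)\varepsilon}\,\Delta_{2,\mu,J}(\varphi)\le \Delta_{1,\mu,J}(\varphi). $$ Consequently, for every $\varphi\in\mathrm{BMO}(\mathcal{T})$, $$ \frac{\sqrt\alpha}{1+\alpha}\,\|\varphi\|_{\mathrm{BMO}(\mathcal{T})}\le \|\varphi\|_{\mathrm{BMO}^1(\mathcal{T})}, $$ where $\|\varphi\|_{\mathrm{BMO}^1(\mathcal{T})}=\sup_{J\in\mathcal{T}}\Delta_{1,\mu,J}(\varphi)$.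
   Context: Notation: $\langle\varphi\rangle_{J,\mu}=\frac1{\mu(J)}\int_J\varphi\,d\mu$ and $\Delta_{p,\mu,J}(\varphi)=\langle|\varphi-\langle\varphi\rangle_{J,\mu}|^p\rangle_{J,\mu}$; functions are real-valued. $\alpha$-tree: let $(X,\mu)$ be a measure space with $0<\mu(X)<\infty$ and $\alpha\in(0,1/2]$. A collection $\mathcal{T}$ of measurable subsets of $X$ is an $\alpha$-tree if: (1) $X\in\mathcal{T}$; (2) for every $J\in\mathcal{T}$ there is a subset $C(J)\subset\mathcal{T}$ (the children of $J$) such that $J=\bigcup_{I\in C(J)}I$, the elements of $C(J)$ are pairwise disjoint up to sets of measure zero, and $\mu(I)\ge\alpha\mu(J)$ for every $I\in C(J)$; (3) $\mathcal{T}=\bigcup_{m\ge0}\mathcal{T}_m$, where $\mathcal{T}_0=\{X\}$ and $\mathcal{T}_{m+1}=\bigcup_{J\in\mathcal{T}_m}C(J)$; (4) $\mathcal{T}$ differentiates $L^1(X,\mu)$, i.e. for every $f\in L^1(X,\mu)$, for $\mu$-a.e. $x$, the averages $\langle f\rangle_{J_m,\mu}$ over the elements $J_m\in\mathcal{T}_m$ containing $x$ converge to $f(x)$ as $m\to\infty$. BMO on the tree: $\varphi\in\mathrm{BMO}(\mathcal{T})$ iff $$\|\varphi\|_{\mathrm{BMO}(\mathcal{T})}:=\sup_{J\in\mathcal{T}}\big(\langle\varphi^2\rangle_{J,\mu}-\langle\varphi\rangle_{J,\mu}^2\big)^{1/2}<\infty$$ (in particular $\varphi\in L^2(X,\mu)$).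 *)

theory Defs
  imports "HOL-Analysis.Analysis"
begin

definition avg :: "'a measure \<Rightarrow> 'a set \<Rightarrow> ('a \<Rightarrow> real) \<Rightarrow> real" where
  "avg M J f = (LINT x:J|M. f x) / measure M J"

definition osc :: "real \<Rightarrow> 'a measure \<Rightarrow> 'a set \<Rightarrow> ('a \<Rightarrow> real) \<Rightarrow> real" where
  "osc p M J f = avg M J (\<lambda>x. \<bar>f x - avg M J f\<bar> powr p)"

primrec tree_level :: "'a set \<Rightarrow> ('a set \<Rightarrow> 'a set set) \<Rightarrow> nat \<Rightarrow> 'a set set" where
  "tree_level X C 0 = {X}"
| "tree_level X C (Suc m) = (\<Union>J\<in>tree_level X C m. C J)"

(* The levels depend on the choice of children, so one choice C serves all the clauses below.
   In the last clause, the levels cover the space, and elements of one level overlap only in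
   null sets; hence for almost every x there is exactly one such sequence S. *)
definition alpha_tree :: "'a measure \<Rightarrow> real \<Rightarrow> 'a set set \<Rightarrow> bool" where
  "alpha_tree M \<alpha> T \<longleftrightarrow>
     T \<subseteq> sets M \<and> space M \<in> T \<and>
     (\<exists>C. (\<forall>J\<in>T. C J \<subseteq> T \<and> J = \<Union>(C J) \<and>
              pairwise (\<lambda>I I'. I \<inter> I' \<in> null_sets M) (C J) \<and>
              (\<forall>I\<in>C J. measure M I \<ge> \<alpha> * measure M J)) \<and>
          T = (\<Union>m. tree_level (space M) C m) \<and>
          (\<forall>f :: 'a \<Rightarrow> real. integrable M f \<longrightarrow>
             (AE x in M. \<forall>S. (\<forall>m. S m \<in> tree_level (space M) C m \<and> x \<in> S m) \<longrightarrow>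
                (\<lambda>m. avg M (S m) f) \<longlonglongrightarrow> f x)))"

(* Extended-real suprema, so that the norm of a function with unbounded oscillation is infinite. *)
definition BMO_norm :: "'a measure \<Rightarrow> 'a set set \<Rightarrow> ('a \<Rightarrow> real) \<Rightarrow> ereal" where
  "BMO_norm M T f = (SUP J\<in>T. ereal (sqrt (avg M J (\<lambda>x. (f x)\<^sup>2) - (avg M J f)\<^sup>2)))"

definition BMO1_norm :: "'a measure \<Rightarrow> 'a set set \<Rightarrow> ('a \<Rightarrow> real) \<Rightarrow> ereal" where
  "BMO1_norm M T f = (SUP J\<in>T. ereal (osc 1 M J f))"

(* Square integrability is stated explicitly: the Bochner integral of a non-integrable
   function is 0, so finiteness of the supremum alone would not imply it. *)
definition BMO :: "'a measure \<Rightarrow> 'a set set \<Rightarrow> ('a \<Rightarrow> real) set" where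
  "BMO M T = {f. f \<in> borel_measurable M \<and> integrable M (\<lambda>x. (f x)\<^sup>2) \<and> BMO_norm M T f < \<infinity>}"

end

theory Submission
  imports Defs
begin

text \<open>Bellman function argument. For \<open>\<delta> = (1 + \<alpha>) \<epsilon> / (2 \<surd>\<alpha>)\<close> consider the function \<open>B\<close> on the
  parabolic strip \<open>x\<^sup>2 \<le> y \<le> x\<^sup>2 + \<delta>\<^sup>2\<close> that equals \<open>y / (2 \<delta>)\<close> in the angle
  \<open>y \<ge> 2 \<delta> \<bar>x\<bar>\<close>, \<open>\<bar>x\<bar> \<le> \<delta>\<close>, between the two tangents from the origin to the upper boundary parabola, and
  \<open>\<bar>x\<bar>\<close> elsewhere. It is convex along segments inside the strip and equals \<open>\<bar>x\<bar>\<close> on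
  the lower boundary. If all variances on the tree are at most \<open>\<epsilon>\<^sup>2\<close>, then
  the segment joining the points \<open>(avg f, avg f\<^sup>2)\<close> of a node and of one of its children stays in
  the strip of width \<open>\<delta>\<^sup>2\<close>, so \<open>B\<close> at a node is at most the weighted mean of its values at
  the children. Descending the tree, and using \<open>B \<le> \<bar>x\<bar> + (y - x\<^sup>2) / (2 \<delta>)\<close> and that the
  mean variance of the \<open>m\<close>-th generation tends to \<open>0\<close>, gives
  \<open>avg f\<^sup>2 / (2 \<delta>) \<le> avg \<bar>f\<bar>\<close> whenever \<open>f\<close> has mean zero.\<close>

section \<open>The Bellman function on the parabolic strip\<close>

definition bellman :: "real \<Rightarrow> real \<Rightarrow> real \<Rightarrow> real" where
  "bellman \<delta> x y = (if \<bar>x\<bar> \<le> \<delta> then max \<bar>x\<bar> (y / (2 * \<delta>)) else \<bar>x\<bar>)"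

lemma bellman_ge_abs: "\<bar>x\<bar> \<le> bellman \<delta> x y"
  by (simp add: bellman_def)

text \<open>For \<open>\<bar>x\<bar> \<le> \<delta>\<close>, \<open>x\<^sup>2\<close> is at most
  \<open>2 * \<delta> * \<bar>x\<bar>\<close>. The excess of \<open>bellman\<close> over the
  absolute value is thus controlled by the height above the lower parabola. At a node this height is
  a variance, so the excess vanishes on average in the limit of fine generations.\<close>

lemma bellman_le:
  assumes "\<delta> > 0" "x\<^sup>2 \<le> y"
  shows "bellman \<delta> x y \<le> \<bar>x\<bar> + (y - x\<^sup>2) / (2 * \<delta>)"
proof -
  have gap: "0 \<le> (y - x\<^sup>2) / (2 * \<delta>)" using assms by simp
  have "y / (2 * \<delta>) \<le> \<bar>x\<bar> + (y - x\<^sup>2) / (2 * \<delta>)" if "\<bar>x\<bar> \<le> \<delta>"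
  proof -
    have "\<bar>x\<bar> * \<bar>x\<bar> \<le> (2 * \<delta>) * \<bar>x\<bar>" by (rule mult_right_mono) (use that assms in auto)
    then have "x\<^sup>2 / (2 * \<delta>) \<le> \<bar>x\<bar>" using assms(1) by (simp add: field_simps power2_eq_square)
    then show ?thesis by (simp add: diff_divide_distrib)
  qed
  with gap show ?thesis by (auto simp: bellman_def)
qed

text \<open>Here \<open>u\<close> and \<open>v\<close> are the heights of the ends of a segment
  above the parabola \<open>y = x\<^sup>2\<close>, and \<open>h\<close> is the squared difference of
  their abscissas. The left side of the conclusion is the height of the point with parameter
  \<open>t\<close>, so the segment stays in the strip of width \<delta> squared. The hypothesis on
  \<open>h\<close> is what \<open>var_subset\<close> supplies for a node and its child.\<close>

lemma segment_bound:
  fixes \<alpha> \<epsilon> :: real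
  assumes "0 < \<alpha>" "\<alpha> < 1" "0 < \<epsilon>" and "0 \<le> t" "t \<le> 1"
    and u: "u \<le> \<epsilon>\<^sup>2" and v: "v \<le> \<epsilon>\<^sup>2"
    and h: "\<alpha> * v + \<alpha> / (1 - \<alpha>) * h \<le> u"
  shows "(1 - t) * u + t * v + t * (1 - t) * h \<le> ((1 + \<alpha>) * \<epsilon> / (2 * sqrt \<alpha>))\<^sup>2"
proof -
  have h': "h \<le> (1 - \<alpha>) / \<alpha> * u - (1 - \<alpha>) * v"
    using h assms(1,2) by (simp add: field_simps)
  have "(1 - t) * u + t * v + t * (1 - t) * h
      \<le> (1 - t) * u + t * v + t * (1 - t) * ((1 - \<alpha>) / \<alpha> * u - (1 - \<alpha>) * v)"
    using assms h' by (intro add_left_mono mult_left_mono) auto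
  also have "\<dots> = (1 - t) * (1 + t * (1 - \<alpha>) / \<alpha>) * u + t * (1 - (1 - t) * (1 - \<alpha>)) * v"
    using assms(1) by (simp add: field_simps)
  also have "\<dots> \<le> (1 - t) * (1 + t * (1 - \<alpha>) / \<alpha>) * \<epsilon>\<^sup>2 + t * (1 - (1 - t) * (1 - \<alpha>)) * \<epsilon>\<^sup>2"
  proof -
    have "(1 - t) * (1 - \<alpha>) \<le> 1 * 1" by (rule mult_mono) (use assms in auto)
    then show ?thesis using assms u v by (intro add_mono mult_left_mono mult_nonneg_nonneg) auto
  qed
  also have "\<dots> = (1 + t * (1 - t) * ((1 - \<alpha>)\<^sup>2 / \<alpha>)) * \<epsilon>\<^sup>2"
    using assms(1) by (simp add: field_simps power2_eq_square)
  \<comment> \<open>The worst case is the midpoint \<open>t = 1/2\<close>. The resulting factor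
    \<open>1 + (1 - \<alpha>)\<^sup>2 / (4 * \<alpha>)\<close> equals
    \<open>(1 + \<alpha>)\<^sup>2 / (4 * \<alpha>)\<close>, which is where the value of \<delta>
    comes from.\<close>
  also have "\<dots> \<le> (1 + 1/4 * ((1 - \<alpha>)\<^sup>2 / \<alpha>)) * \<epsilon>\<^sup>2"
  proof -
    have "t * (1 - t) = 1/4 - (t - 1/2)\<^sup>2" by (simp add: power2_eq_square algebra_simps)
    then have "t * (1 - t) \<le> 1/4" by simp
    then show ?thesis using assms(1) by (intro mult_right_mono add_left_mono) auto
  qed
  also have "\<dots> = ((1 + \<alpha>) * \<epsilon> / (2 * sqrt \<alpha>))\<^sup>2"
    using assms(1) by (simp add: power_divide power_mult_distrib) (simp add: field_simps power2_eq_square)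
  finally show ?thesis .
qed

text \<open>The line \<open>y = 2 * \<delta> * x\<close> touches the upper parabola at abscissa
  \<delta>. If both ends of the segment were above this line, the segment would cross abscissa
  \<delta> strictly above the point of tangency and so leave the strip, contrary to
  \<open>segment_bound\<close>.\<close>

lemma below_tangent_pos:
  fixes \<alpha> \<epsilon> :: real
  assumes "0 < \<alpha>" "\<alpha> < 1" "0 < \<epsilon>" and \<delta>: "\<delta> = (1 + \<alpha>) * \<epsilon> / (2 * sqrt \<alpha>)"
    and x: "x1 \<le> \<delta>" "2 * \<delta> * x1 < x2" "x2 - x1\<^sup>2 \<le> \<epsilon>\<^sup>2"
    and y: "\<delta> < y1" "y2 - y1\<^sup>2 \<le> \<epsilon>\<^sup>2"
    and xy: "\<alpha> * (y2 - y1\<^sup>2) + \<alpha> / (1 - \<alpha>) * (y1 - x1)\<^sup>2 \<le> x2 - x1\<^sup>2"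
  shows "y2 \<le> 2 * \<delta> * y1"
proof (rule ccontr)
  assume "\<not> y2 \<le> 2 * \<delta> * y1"
  \<comment> \<open>The parameter at which the segment has abscissa \<delta>.\<close>
  define t where "t = (\<delta> - x1) / (y1 - x1)"
  have t: "0 \<le> t" "t \<le> 1" using x y by (auto simp: t_def)
  have t\<delta>: "(1 - t) * x1 + t * y1 = \<delta>"
  proof -
    have "t * (y1 - x1) = \<delta> - x1" using x y by (simp add: t_def)
    then show ?thesis by (simp add: algebra_simps)
  qed
  have "(1 - t) * (x2 - x1\<^sup>2) + t * (y2 - y1\<^sup>2) + t * (1 - t) * (y1 - x1)\<^sup>2 \<le> \<delta>\<^sup>2"
    unfolding \<delta> by (rule segment_bound) (use assms t in auto)
  moreover have "(1 - t) * (x2 - x1\<^sup>2) + t * (y2 - y1\<^sup>2) + t * (1 - t) * (y1 - x1)\<^sup>2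
      = (1 - t) * x2 + t * y2 - ((1 - t) * x1 + t * y1)\<^sup>2"
    by (simp add: power2_eq_square algebra_simps)
  ultimately have *: "(1 - t) * x2 + t * y2 \<le> 2 * \<delta> * \<delta>"
    unfolding t\<delta> by (simp add: power2_eq_square)
  have "(1 - t) * (x2 - 2 * \<delta> * x1) + t * (y2 - 2 * \<delta> * y1) > 0"
  proof (cases "t = 0")
    case False
    then show ?thesis using t x \<open>\<not> y2 \<le> _\<close> by (intro add_nonneg_pos mult_nonneg_nonneg mult_pos_pos) auto
  qed (use x in simp)
  moreover have "(1 - t) * (x2 - 2 * \<delta> * x1) + t * (y2 - 2 * \<delta> * y1)
     = (1 - t) * x2 + t * y2 - 2 * \<delta> * ((1 - t) * x1 + t * y1)"
    by (simp add: algebra_simps)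
  ultimately show False using * unfolding t\<delta> by simp
qed

text \<open>In the angle \<open>bellman\<close> is the linear function
  \<open>y / (2 * \<delta>)\<close>. This shows that it still dominates that function at the other
  end of an admissible segment, even when that end has left the angle. For
  \<open>\<bar>y1\<bar> \<le> \<delta>\<close> the \<open>max\<close> gives it at once; otherwise
  one of the two tangents does.\<close>

lemma bellman_ge_tangent:
  fixes \<alpha> \<epsilon> :: real
  assumes "0 < \<alpha>" "\<alpha> < 1" "0 < \<epsilon>" and \<delta>: "\<delta> = (1 + \<alpha>) * \<epsilon> / (2 * sqrt \<alpha>)"
    and x: "\<bar>x1\<bar> \<le> \<delta>" "2 * \<delta> * \<bar>x1\<bar> < x2" "x2 - x1\<^sup>2 \<le> \<epsilon>\<^sup>2"
    and y: "y2 - y1\<^sup>2 \<le> \<epsilon>\<^sup>2"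
    and xy: "\<alpha> * (y2 - y1\<^sup>2) + \<alpha> / (1 - \<alpha>) * (y1 - x1)\<^sup>2 \<le> x2 - x1\<^sup>2"
  shows "y2 / (2 * \<delta>) \<le> bellman \<delta> y1 y2"
proof -
  have \<delta>0: "\<delta> > 0" using assms by simp
  have abs: "2 * \<delta> * x1 \<le> 2 * \<delta> * \<bar>x1\<bar>" "2 * \<delta> * - x1 \<le> 2 * \<delta> * \<bar>x1\<bar>"
    by (intro mult_left_mono; use \<delta>0 in simp)+
  consider "\<bar>y1\<bar> \<le> \<delta>" | "\<delta> < y1" | "\<delta> < - y1" by linarith
  then show ?thesis
  proof cases
    case 1
    then show ?thesis by (simp add: bellman_def)
  next
    case 2
    have "y2 \<le> 2 * \<delta> * y1"
      by (rule below_tangent_pos[OF assms(1-4), of x1 x2]) (use 2 x y xy abs in auto)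
    then show ?thesis using 2 \<delta>0 by (simp add: bellman_def field_simps)
  next
    case 3
    \<comment> \<open>Reflection in the vertical axis reduces the left tangent to the right
      one.\<close>
    have "y2 \<le> 2 * \<delta> * - y1"
      by (rule below_tangent_pos[OF assms(1-4), of "- x1" x2])
        (use 3 x y xy abs in \<open>auto simp: power2_commute\<close>)
    then show ?thesis using 3 \<delta>0 by (simp add: bellman_def field_simps)
  qed
qed

section \<open>Finite families that are disjoint up to null sets\<close>

lemma AE_unique_of_pairwise_null:
  assumes "finite A" "pairwise (\<lambda>I I'. I \<inter> I' \<in> null_sets M) A"
  shows "AE x in M. \<forall>I\<in>A. \<forall>I'\<in>A. x \<in> I \<longrightarrow> x \<in> I' \<longrightarrow> I = I'"
proof (intro AE_finite_allI assms)
  fix I I' assume "I \<in> A" "I' \<in> A"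
  show "AE x in M. x \<in> I \<longrightarrow> x \<in> I' \<longrightarrow> I = I'"
  proof (cases "I = I'")
    case False
    then have "I \<inter> I' \<in> null_sets M" using assms \<open>I \<in> A\<close> \<open>I' \<in> A\<close> by (auto simp: pairwise_def)
    from AE_not_in[OF this] show ?thesis by eventually_elim auto
  qed simp
qed

lemma sum_indicator_unique:
  fixes c :: "'a set \<Rightarrow> real"
  assumes "finite A" "S \<in> A" "x \<in> S" "\<And>I. I \<in> A \<Longrightarrow> x \<in> I \<Longrightarrow> I = S"
  shows "(\<Sum>I\<in>A. indicator I x * c I) = c S"
proof -
  have "indicator I x * c I = (if I = S then c S else 0)" if "I \<in> A" for I
  proof (cases "x \<in> I")
    case True
    then have "I = S" using assms(4) that by blast
    then show ?thesis using assms(3) by simp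
  next
    case False
    then have "I \<noteq> S" using assms(3) by blast
    then show ?thesis using False by simp
  qed
  then have "(\<Sum>I\<in>A. indicator I x * c I) = (\<Sum>I\<in>A. if I = S then c S else 0)"
    by (rule sum.cong[OF refl])
  also have "\<dots> = c S" using assms(1,2) by simp
  finally show ?thesis .
qed

text \<open>Almost every point of the union lies in exactly one member, so the indicator of the
  union is almost everywhere the sum of the indicators.\<close>

lemma set_integral_Union_pairwise_null:
  fixes f :: "'a \<Rightarrow> real"
  assumes "finite A" "A \<subseteq> sets M" "integrable M f"
    and null: "pairwise (\<lambda>I I'. I \<inter> I' \<in> null_sets M) A"
  shows "(LINT x:\<Union>A|M. f x) = (\<Sum>I\<in>A. LINT x:I|M. f x)"
proof -
  have int: "integrable M (\<lambda>x. indicator I x * f x)" if "I \<in> sets M" for I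
    using integrable_mult_indicator[OF that assms(3)] by simp
  have un: "\<Union>A \<in> sets M" using assms by auto
  have meas: "(\<lambda>x. \<Sum>I\<in>A. indicator I x * f x) \<in> borel_measurable M"
    using assms(2) int by (intro borel_measurable_sum borel_measurable_integrable) auto
  have "(LINT x:\<Union>A|M. f x) = (LINT x|M. indicator (\<Union>A) x * f x)"
    by (simp add: set_lebesgue_integral_def)
  also have "\<dots> = (LINT x|M. (\<Sum>I\<in>A. indicator I x * f x))"
  proof (rule integral_cong_AE)
    show "AE x in M. indicator (\<Union>A) x * f x = (\<Sum>I\<in>A. indicator I x * f x)"
      using AE_unique_of_pairwise_null[OF assms(1) null]
    proof eventually_elim
      case (elim x)
      show ?case
      proof (cases "x \<in> \<Union>A")
        case True
        then obtain S where "S \<in> A" "x \<in> S" by auto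
        then have "(\<Sum>I\<in>A. indicator I x * f x) = f x"
          using elim by (intro sum_indicator_unique[of A S x "\<lambda>_. f x"] assms(1)) auto
        then show ?thesis using True by simp
      qed (auto simp: indicator_def intro!: sum.neutral[symmetric])
    qed
  qed (use int[OF un] meas in auto)
  also have "\<dots> = (\<Sum>I\<in>A. LINT x:I|M. f x)"
    using assms(2) int by (subst Bochner_Integration.integral_sum) (auto simp: set_lebesgue_integral_def)
  finally show ?thesis .
qed

section \<open>Averages and variances\<close>

definition var :: "'a measure \<Rightarrow> 'a set \<Rightarrow> ('a \<Rightarrow> real) \<Rightarrow> real" where
  "var M J f = avg M J (\<lambda>x. (f x)\<^sup>2) - (avg M J f)\<^sup>2"

context finite_measure
begin

lemma set_integrable_of_integrable:
  fixes f :: "'a \<Rightarrow> real"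
  assumes "integrable M f" "J \<in> sets M"
  shows "set_integrable M J f"
  unfolding set_integrable_def using assms by (intro integrable_mult_indicator)

lemma set_integral_eq_avg: "0 < measure M J \<Longrightarrow> (LINT x:J|M. f x) = measure M J * avg M J f"
  by (simp add: avg_def)

lemma abs_avg_le:
  fixes f :: "'a \<Rightarrow> real"
  shows "\<bar>avg M J f\<bar> \<le> avg M J (\<lambda>x. \<bar>f x\<bar>)"
proof -
  have "\<bar>LINT x:J|M. f x\<bar> \<le> (LINT x:J|M. \<bar>f x\<bar>)"
    unfolding set_lebesgue_integral_def
    using integral_abs_bound[of M "\<lambda>x. indicator J x *\<^sub>R f x"] by (simp add: abs_mult)
  then show ?thesis by (simp add: avg_def divide_right_mono)
qed

lemma avg_diff_const:
  assumes "integrable M f" "J \<in> sets M" "0 < measure M J"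
  shows "avg M J (\<lambda>x. f x - c) = avg M J f - c"
  using assms set_integrable_of_integrable[of "\<lambda>_. c" J]
  by (simp add: avg_def set_integrable_of_integrable diff_divide_distrib set_integral_const)

text \<open>The parallel axis identity, obtained by expanding the square. Nonnegativity and
  translation invariance of \<open>var\<close>, its comparison on subsets and the formula for
  \<open>osc 2\<close> all rest on it.\<close>

lemma avg_sq_diff_const:
  assumes "integrable M f" "integrable M (\<lambda>x. (f x)\<^sup>2)" "J \<in> sets M" "0 < measure M J"
  shows "avg M J (\<lambda>x. (f x - c)\<^sup>2) = var M J f + (avg M J f - c)\<^sup>2"
proof -
  have "(\<lambda>x. (f x - c)\<^sup>2) = (\<lambda>x. (f x)\<^sup>2 - 2 * c * f x + c\<^sup>2)"
    by (rule ext) (simp add: power2_eq_square algebra_simps)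
  then have "(LINT x:J|M. (f x - c)\<^sup>2) = (LINT x:J|M. (f x)\<^sup>2 - 2 * c * f x + c\<^sup>2)"
    by (rule arg_cong)
  also have "\<dots> = (LINT x:J|M. (f x)\<^sup>2) - 2 * c * (LINT x:J|M. f x) + measure M J * c\<^sup>2"
    using assms(1-3) set_integrable_of_integrable[of "\<lambda>_. c\<^sup>2" J]
    by (simp add: set_integrable_of_integrable set_integral_const)
  finally have eq: "(LINT x:J|M. (f x - c)\<^sup>2) = \<dots>" .
  have "(b - 2 * c * a + m * c\<^sup>2) / m = b / m - (a / m)\<^sup>2 + (a / m - c)\<^sup>2" if "0 < m" for a b m
    using that by (simp add: field_simps power2_eq_square)
  then show ?thesis unfolding avg_def var_def eq using assms(4) .
qed

lemma var_nonneg: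
  assumes "integrable M f" "integrable M (\<lambda>x. (f x)\<^sup>2)" "J \<in> sets M" "0 < measure M J"
  shows "0 \<le> var M J f"
proof -
  have "0 \<le> avg M J (\<lambda>x. (f x - avg M J f)\<^sup>2)"
    by (simp add: avg_def set_lebesgue_integral_def)
  then show ?thesis using avg_sq_diff_const[OF assms] by simp
qed

lemma integrable_sq_diff_const:
  fixes f :: "'a \<Rightarrow> real"
  assumes "integrable M f" "integrable M (\<lambda>x. (f x)\<^sup>2)"
  shows "integrable M (\<lambda>x. (f x - c)\<^sup>2)"
proof -
  have "integrable M (\<lambda>x. (f x)\<^sup>2 - 2 * c * f x + c\<^sup>2)" using assms by simp
  moreover have "(\<lambda>x. (f x - c)\<^sup>2) = (\<lambda>x. (f x)\<^sup>2 - 2 * c * f x + c\<^sup>2)"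
    by (rule ext) (simp add: power2_eq_square algebra_simps)
  ultimately show ?thesis by metis
qed

lemma var_diff_const:
  assumes "integrable M f" "integrable M (\<lambda>x. (f x)\<^sup>2)" "J \<in> sets M" "0 < measure M J"
  shows "var M J (\<lambda>x. f x - c) = var M J f"
  unfolding var_def[of M J "\<lambda>x. f x - c"] avg_sq_diff_const[OF assms] avg_diff_const[OF assms(1,3,4)]
  by simp

text \<open>Compare the integrals of \<open>(f - l)\<^sup>2\<close> over \<open>I\<close> and \<open>J\<close>; the constant
  \<open>l = (avg J f - \<alpha> avg I f) / (1 - \<alpha>)\<close> is the mean of \<open>f\<close> over \<open>J - I\<close> in the
  extremal case \<open>measure I = \<alpha> measure J\<close>.\<close>
lemma var_subset:
  assumes f: "integrable M f" "integrable M (\<lambda>x. (f x)\<^sup>2)"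
    and J: "J \<in> sets M" "0 < measure M J" and I: "I \<in> sets M" "I \<subseteq> J"
    and \<alpha>: "0 < \<alpha>" "\<alpha> < 1" "\<alpha> * measure M J \<le> measure M I"
  shows "\<alpha> * var M I f + \<alpha> / (1 - \<alpha>) * (avg M I f - avg M J f)\<^sup>2 \<le> var M J f"
proof -
  define d where "d = avg M I f - avg M J f"
  define l where "l = avg M J f - \<alpha> * d / (1 - \<alpha>)"
  have I0: "0 < measure M I" by (rule less_le_trans[OF mult_pos_pos[OF \<alpha>(1) J(2)] \<alpha>(3)])
  have int: "integrable M (\<lambda>x. (f x - l)\<^sup>2)" using f by (rule integrable_sq_diff_const)
  have dl: "avg M I f - l = d / (1 - \<alpha>)" "avg M J f - l = \<alpha> * d / (1 - \<alpha>)"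
    using \<alpha>(2) by (simp_all add: l_def d_def field_simps)
  have "(LINT x:I|M. (f x - l)\<^sup>2) \<le> (LINT x:J|M. (f x - l)\<^sup>2)"
    unfolding set_lebesgue_integral_def
    using I(2) by (intro integral_mono integrable_mult_indicator int I J) (auto split: split_indicator)
  then have le: "measure M I * (var M I f + (d / (1 - \<alpha>))\<^sup>2) \<le> measure M J * (var M J f + (\<alpha> * d / (1 - \<alpha>))\<^sup>2)"
    using I0 I(1) J f by (simp add: set_integral_eq_avg avg_sq_diff_const dl)
  \<comment> \<open>Lowering the weight from \<open>measure M I\<close> to
    \<open>\<alpha> * measure M J\<close> is allowed because the bracket is nonnegative.\<close>
  have "\<alpha> * measure M J * (var M I f + (d / (1 - \<alpha>))\<^sup>2) \<le> measure M I * (var M I f + (d / (1 - \<alpha>))\<^sup>2)"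
    using var_nonneg[OF f I(1) I0] \<alpha>(3) by (intro mult_right_mono) auto
  with le have "measure M J * (\<alpha> * (var M I f + (d / (1 - \<alpha>))\<^sup>2)) \<le> measure M J * (var M J f + (\<alpha> * d / (1 - \<alpha>))\<^sup>2)"
    by (simp add: mult_ac)
  then have "\<alpha> * (var M I f + (d / (1 - \<alpha>))\<^sup>2) \<le> var M J f + (\<alpha> * d / (1 - \<alpha>))\<^sup>2"
    using J(2) by simp
  moreover have "\<alpha> * (d / (1 - \<alpha>))\<^sup>2 - (\<alpha> * d / (1 - \<alpha>))\<^sup>2 = \<alpha> / (1 - \<alpha>) * d\<^sup>2"
  proof -
    have "\<alpha> * (d / (1 - \<alpha>))\<^sup>2 - (\<alpha> * d / (1 - \<alpha>))\<^sup>2 = \<alpha> * (1 - \<alpha>) * d\<^sup>2 / (1 - \<alpha>)\<^sup>2"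
      by (simp add: power_divide power2_eq_square field_simps flip: diff_divide_distrib)
    then show ?thesis using \<alpha>(2) by (simp add: power2_eq_square)
  qed
  ultimately show ?thesis by (simp add: d_def distrib_left)
qed

end

section \<open>Trees of sets and their generations\<close>

text \<open>The existential over children maps in \<open>alpha_tree\<close> is replaced by a fixed
  parameter \<open>C\<close>, so that generations below any node can be named.\<close>

locale measure_tree = finite_measure M for M :: "'a measure" +
  fixes \<alpha> :: real and T :: "'a set set" and C :: "'a set \<Rightarrow> 'a set set"
  assumes space_pos: "0 < measure M (space M)"
    and alpha: "0 < \<alpha>" "\<alpha> < 1"
    and T_sets: "T \<subseteq> sets M"
    and space_T: "space M \<in> T"
    and children_T: "J \<in> T \<Longrightarrow> C J \<subseteq> T"
    and children_Union: "J \<in> T \<Longrightarrow> \<Union>(C J) = J"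
    and children_null: "J \<in> T \<Longrightarrow> pairwise (\<lambda>I I'. I \<inter> I' \<in> null_sets M) (C J)"
    and children_measure: "J \<in> T \<Longrightarrow> I \<in> C J \<Longrightarrow> \<alpha> * measure M J \<le> measure M I"
    and T_levels: "T = (\<Union>m. tree_level (space M) C m)"
    and differentiates: "\<And>f :: 'a \<Rightarrow> real. integrable M f \<Longrightarrow>
      AE x in M. \<forall>S. (\<forall>m. S m \<in> tree_level (space M) C m \<and> x \<in> S m) \<longrightarrow>
        (\<lambda>m. avg M (S m) f) \<longlonglongrightarrow> f x"
begin

abbreviation level :: "'a set \<Rightarrow> nat \<Rightarrow> 'a set set" where
  "level J \<equiv> tree_level J C"

text \<open>Every node is reached from the root in finitely many steps, each of which keeps at least
  the fraction \<alpha> of the measure.\<close>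

lemma measure_pos: "J \<in> T \<Longrightarrow> 0 < measure M J"
proof -
  have "\<forall>J\<in>level (space M) m. 0 < measure M J" for m
  proof (induction m)
    case (Suc m)
    have "level (space M) m \<subseteq> T" using T_levels by auto
    then show ?case using Suc children_measure alpha(1) by (fastforce intro: less_le_trans[OF mult_pos_pos])
  qed (use space_pos in simp)
  then show "J \<in> T \<Longrightarrow> 0 < measure M J" using T_levels by auto
qed

text \<open>Almost disjoint subsets of \<open>J\<close>, each of measure at least
  \<open>\<alpha> * measure M J\<close>, number at most \<open>1 / \<alpha>\<close>.\<close>

lemma finite_children:
  assumes J: "J \<in> T"
  shows "finite (C J)"
proof -
  have "card G \<le> nat \<lfloor>1 / \<alpha>\<rfloor>" if G: "G \<subseteq> C J" "finite G" for G
  proof -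
    have sub: "G \<subseteq> sets M" using G J children_T T_sets by blast
    have "pairwise (\<lambda>I I'. I \<inter> I' \<in> null_sets M) G"
      using children_null[OF J] G(1) by (rule pairwise_subset)
    then have ae: "pairwise (\<lambda>I I'. AE x in M. x \<notin> I \<or> x \<notin> I') G"
      by (rule pairwise_mono) (auto dest: AE_not_in)
    have "real (card G) * (\<alpha> * measure M J) \<le> (\<Sum>I\<in>G. measure M I)"
      using G J children_measure by (intro sum_bounded_below) auto
    also have "\<dots> = measure M (\<Union>I\<in>G. I)"
      using sub ae by (intro measure_UNION_AE[symmetric] G) (auto simp: fmeasurable_eq_sets)
    also have "\<dots> \<le> measure M J"
      using G J T_sets children_Union[OF J] by (intro finite_measure_mono) auto
    finally have "real (card G) * \<alpha> \<le> 1" using measure_pos[OF J] by (simp add: mult_ac)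
    then show ?thesis using alpha by (simp add: le_nat_floor field_simps)
  qed
  then show ?thesis using finite_if_finite_subsets_card_bdd by blast
qed

lemma level_T: "J \<in> T \<Longrightarrow> level J m \<subseteq> T"
  using children_T by (induction m) (simp_all, blast)

lemma finite_level: "J \<in> T \<Longrightarrow> finite (level J m)"
proof (induction m)
  case (Suc m)
  then show ?case using level_T[of J m] by (auto intro: finite_children)
qed simp

lemma Union_level: "J \<in> T \<Longrightarrow> \<Union>(level J m) = J"
proof (induction m)
  case (Suc m)
  have "\<Union>(level J (Suc m)) = (\<Union>K\<in>level J m. \<Union>(C K))" by auto
  also have "\<dots> = (\<Union>K\<in>level J m. K)"
    using level_T[OF Suc.prems, of m] children_Union by (intro SUP_cong) auto
  finally show ?case using Suc by simp
qed simp

lemma level_null: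
  assumes "J \<in> T"
  shows "pairwise (\<lambda>I I'. I \<inter> I' \<in> null_sets M) (level J m)"
proof (induction m)
  case (Suc m)
  show ?case
  proof (rule pairwiseI)
    fix I I' assume I: "I \<in> level J (Suc m)" "I' \<in> level J (Suc m)" and "I \<noteq> I'"
    then obtain K K' where K: "K \<in> level J m" "K' \<in> level J m" "I \<in> C K" "I' \<in> C K'" by auto
    then have KT: "K \<in> T" "K' \<in> T" using level_T[OF assms] by auto
    show "I \<inter> I' \<in> null_sets M"
    proof (cases "K = K'")
      case True
      then show ?thesis using K KT children_null \<open>I \<noteq> I'\<close> by (auto simp: pairwise_def)
    next
      case False
      then have "K \<inter> K' \<in> null_sets M" using Suc K by (auto simp: pairwise_def)
      moreover have "I \<inter> I' \<subseteq> K \<inter> K'" using children_Union KT K by blast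
      moreover have "I \<inter> I' \<in> sets M" using level_T[OF assms, of "Suc m"] T_sets I by blast
      ultimately show ?thesis by (blast intro: null_sets_subset)
    qed
  qed
qed simp

text \<open>A level is a set, so a node with two parents in one level would be counted once on the
  left and twice on the right. Such a node would lie in the null intersection of its parents, which
  its positive measure forbids.\<close>

lemma sum_level_Suc:
  fixes F :: "'a set \<Rightarrow> real"
  assumes "J \<in> T"
  shows "(\<Sum>I\<in>level J (Suc m). F I) = (\<Sum>K\<in>level J m. \<Sum>I\<in>C K. F I)"
proof -
  have "C K \<inter> C K' = {}" if K: "K \<in> level J m" "K' \<in> level J m" "K \<noteq> K'" for K K'
  proof (rule ccontr)
    assume "C K \<inter> C K' \<noteq> {}"
    then obtain I where I: "I \<in> C K" "I \<in> C K'" by auto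
    have KT: "K \<in> T" "K' \<in> T" using K level_T[OF assms] by auto
    have "K \<inter> K' \<in> null_sets M" using level_null[OF assms] K by (auto simp: pairwise_def)
    moreover have "I \<subseteq> K \<inter> K'" using children_Union KT I by blast
    moreover have "I \<in> T" using children_T KT I by auto
    ultimately have "I \<in> null_sets M" using T_sets by (blast intro: null_sets_subset)
    then show False using measure_pos[OF \<open>I \<in> T\<close>] by (simp add: measure_def null_sets_def)
  qed
  moreover have "finite (C K)" if "K \<in> level J m" for K
    using that level_T[OF assms] finite_children by auto
  ultimately show ?thesis
    by (simp, intro sum.UNION_disjoint finite_level assms) auto
qed

text \<open>Applied to \<open>f\<close> and its square, this makes the point of a node the weighted
  mean of the points of its descendants in one generation.\<close>

lemma sum_level_avg:
  assumes "J \<in> T" "integrable M f"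
  shows "(\<Sum>I\<in>level J m. measure M I * avg M I f) = measure M J * avg M J f"
proof -
  have "(\<Sum>I\<in>level J m. measure M I * avg M I f) = (\<Sum>I\<in>level J m. LINT x:I|M. f x)"
    using level_T[OF assms(1)] measure_pos
    by (intro sum.cong refl set_integral_eq_avg[symmetric]) blast
  also have "\<dots> = (LINT x:\<Union>(level J m)|M. f x)"
    using assms level_T[OF assms(1), of m] T_sets
    by (intro set_integral_Union_pairwise_null[symmetric] finite_level level_null) auto
  finally show ?thesis using assms by (simp add: Union_level set_integral_eq_avg measure_pos)
qed

lemma sum_children_avg:
  assumes "J \<in> T" "integrable M f"
  shows "(\<Sum>I\<in>C J. measure M I * avg M I f) = measure M J * avg M J f"
  using sum_level_avg[OF assms, of "Suc 0"] by simp

lemma level_subset_level_space: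
  assumes "J \<in> level (space M) k"
  shows "level J m \<subseteq> level (space M) (k + m)"
  using assms by (induction m) (simp_all, blast)

text \<open>The differentiation property is transferred from the root to \<open>J\<close> by prepending
  arbitrary elements of the first levels to a sequence descending from \<open>J\<close>.\<close>
lemma differentiates_below:
  fixes f :: "'a \<Rightarrow> real"
  assumes "J \<in> T" "integrable M f"
  shows "AE x in M. \<forall>S. (\<forall>m. S m \<in> level J m \<and> x \<in> S m) \<longrightarrow> (\<lambda>m. avg M (S m) f) \<longlonglongrightarrow> f x"
  using differentiates[OF assms(2)] AE_space
proof eventually_elim
  case (elim x)
  obtain k where k: "J \<in> level (space M) k" using assms(1) T_levels by auto
  have "\<exists>R. \<forall>m. R m \<in> level (space M) m \<and> x \<in> R m"
    using Union_level[OF space_T] \<open>x \<in> space M\<close> by (intro choice) blast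
  then obtain R where R: "\<And>m. R m \<in> level (space M) m" "\<And>m. x \<in> R m" by auto
  show ?case
  proof (intro allI impI)
    fix S assume S: "\<forall>m. S m \<in> level J m \<and> x \<in> S m"
    define S' where "S' m = (if m < k then R m else S (m - k))" for m
    have "S' m \<in> level (space M) m \<and> x \<in> S' m" for m
      using R S level_subset_level_space[OF k, of "m - k"] by (auto simp: S'_def)
    then have "(\<lambda>m. avg M (S' m) f) \<longlonglongrightarrow> f x" using elim(1) by blast
    then have "(\<lambda>m. avg M (S' (m + k)) f) \<longlonglongrightarrow> f x" by (rule LIMSEQ_ignore_initial_segment)
    then show "(\<lambda>m. avg M (S m) f) \<longlonglongrightarrow> f x" by (simp add: S'_def)
  qed
qed

text \<open>The sum is the integral of the step function \<open>G m\<close>, whose value at almost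
  every point of \<open>J\<close> is the variance on the node of generation \<open>m\<close>
  containing it. Differentiation of \<open>f\<close> and of its square sends this value to 0, and
  dominated convergence applies because the variances are bounded.\<close>

lemma sum_level_var_tendsto_0:
  assumes J: "J \<in> T" and f: "integrable M f" "integrable M (\<lambda>x. (f x)\<^sup>2)"
    and V: "\<And>I. I \<in> T \<Longrightarrow> var M I f \<le> V"
  shows "(\<lambda>m. \<Sum>I\<in>level J m. measure M I * var M I f) \<longlonglongrightarrow> 0"
proof -
  define G where "G m x = (\<Sum>I\<in>level J m. indicator I x * var M I f)" for m x
  have levelM: "I \<in> sets M" "I \<in> T" if "I \<in> level J m" for I m
    using that level_T[OF J] T_sets by blast+
  have "(\<Sum>I\<in>level J m. measure M I * var M I f) = (LINT x|M. G m x)" for m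
    using levelM unfolding G_def
    by (subst Bochner_Integration.integral_sum) (auto simp: emeasure_finite less_top[symmetric])
  moreover have "(\<lambda>m. LINT x|M. G m x) \<longlonglongrightarrow> (LINT x|M. 0)"
  proof (rule integral_dominated_convergence)
    have "AE x in M. \<forall>m. \<forall>I\<in>level J m. \<forall>I'\<in>level J m. x \<in> I \<longrightarrow> x \<in> I' \<longrightarrow> I = I'"
      unfolding AE_all_countable
      using AE_unique_of_pairwise_null[OF finite_level level_null, OF J J] by blast
    then have ae: "AE x in M. (\<forall>m. G m x = 0) \<or>
       (\<exists>S. (\<forall>m. S m \<in> level J m \<and> x \<in> S m) \<and> (\<forall>m. G m x = var M (S m) f))"
    proof eventually_elim
      case (elim x)
      show ?case
      proof (cases "x \<in> J")
        case True
        \<comment> \<open>The differentiation property covers every selection of one node through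
          \<open>x\<close> per generation, so the nodes may be chosen independently.\<close>
        have "\<exists>S. \<forall>m. S m \<in> level J m \<and> x \<in> S m"
          using Union_level[OF J] True by (intro choice) blast
        then obtain S where S: "\<And>m. S m \<in> level J m" "\<And>m. x \<in> S m" by auto
        have "G m x = var M (S m) f" for m
          unfolding G_def using S elim by (intro sum_indicator_unique finite_level J) auto
        then show ?thesis using S by blast
      next
        case False
        then have "G m x = 0" for m
          using Union_level[OF J, of m] by (auto simp: G_def intro!: sum.neutral)
        then show ?thesis by simp
      qed
    qed
    show "AE x in M. (\<lambda>m. G m x) \<longlonglongrightarrow> 0"
      using ae differentiates_below[OF J f(1)] differentiates_below[OF J f(2)]
    proof eventually_elim
      case (elim x)
      from elim(1) show ?case
      proof
        assume "\<exists>S. (\<forall>m. S m \<in> level J m \<and> x \<in> S m) \<and> (\<forall>m. G m x = var M (S m) f)"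
        then obtain S where S: "\<forall>m. S m \<in> level J m \<and> x \<in> S m" "\<And>m. G m x = var M (S m) f" by blast
        then have "(\<lambda>m. avg M (S m) f) \<longlonglongrightarrow> f x" "(\<lambda>m. avg M (S m) (\<lambda>x. (f x)\<^sup>2)) \<longlonglongrightarrow> (f x)\<^sup>2"
          using elim(2,3) by blast+
        then have "(\<lambda>m. var M (S m) f) \<longlonglongrightarrow> (f x)\<^sup>2 - (f x)\<^sup>2"
          unfolding var_def by (intro tendsto_intros)
        then show ?thesis by (simp add: S(2))
      qed simp
    qed
    \<comment> \<open>The absolute value lets the bound also cover \<open>G m x = 0\<close> outside
      \<open>J\<close> without first settling the sign of \<open>V\<close>.\<close>
    show "AE x in M. norm (G m x) \<le> \<bar>V\<bar>" for m
      using ae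
    proof eventually_elim
      case (elim x)
      then consider "G m x = 0" | I where "I \<in> level J m" "G m x = var M I f" by blast
      then show ?case
      proof cases
        case 2
        then have "I \<in> T" "I \<in> sets M" using levelM by blast+
        then show ?thesis using V[of I] var_nonneg[OF f, of I] measure_pos 2 by simp
      qed simp
    qed
    show "G m \<in> borel_measurable M" for m
      unfolding G_def using levelM by (intro borel_measurable_sum borel_measurable_times) auto
  qed auto
  ultimately show ?thesis by simp
qed

end

section \<open>Bellman induction down the tree\<close>

context measure_tree
begin

abbreviation node :: "real \<Rightarrow> ('a \<Rightarrow> real) \<Rightarrow> 'a set \<Rightarrow> real" where
  "node \<delta> f J \<equiv> bellman \<delta> (avg M J f) (avg M J (\<lambda>x. (f x)\<^sup>2))"

text \<open>Only the segments from the parent to each child enter, so the number of children does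
  not matter. If the parent is inside the angle, \<open>bellman\<close> is linear there and
  dominates the same linear function at every child. Otherwise it equals the absolute value at the
  parent, and the triangle inequality suffices.\<close>

lemma bellman_le_children:
  assumes J: "J \<in> T" and f: "integrable M f" "integrable M (\<lambda>x. (f x)\<^sup>2)"
    and \<epsilon>: "0 < \<epsilon>" "\<And>I. I \<in> T \<Longrightarrow> var M I f \<le> \<epsilon>\<^sup>2"
    and \<delta>: "\<delta> = (1 + \<alpha>) * \<epsilon> / (2 * sqrt \<alpha>)"
  shows "measure M J * node \<delta> f J \<le> (\<Sum>I\<in>C J. measure M I * node \<delta> f I)"
proof (cases "\<bar>avg M J f\<bar> \<le> \<delta> \<and> 2 * \<delta> * \<bar>avg M J f\<bar> < avg M J (\<lambda>x. (f x)\<^sup>2)")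
  case True
  have \<delta>0: "0 < \<delta>" using \<delta> \<epsilon>(1) alpha by simp
  have "node \<delta> f J = avg M J (\<lambda>x. (f x)\<^sup>2) / (2 * \<delta>)"
    using True \<delta>0 by (simp add: bellman_def max_def field_simps)
  then have "measure M J * node \<delta> f J = (\<Sum>I\<in>C J. measure M I * (avg M I (\<lambda>x. (f x)\<^sup>2) / (2 * \<delta>)))"
    using sum_children_avg[OF J f(2)] by (simp add: sum_divide_distrib[symmetric])
  also have "\<dots> \<le> (\<Sum>I\<in>C J. measure M I * node \<delta> f I)"
  proof (intro sum_mono mult_left_mono)
    fix I assume I: "I \<in> C J"
    then have IT: "I \<in> T" and IJ: "I \<subseteq> J" using J children_T children_Union by blast+
    have "\<alpha> * var M I f + \<alpha> / (1 - \<alpha>) * (avg M I f - avg M J f)\<^sup>2 \<le> var M J f"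
      using f IT IJ J T_sets measure_pos alpha children_measure[OF J I] by (intro var_subset) auto
    then show "avg M I (\<lambda>x. (f x)\<^sup>2) / (2 * \<delta>) \<le> node \<delta> f I"
      using True \<epsilon>(2)[OF J] \<epsilon>(2)[OF IT]
      by (intro bellman_ge_tangent[OF alpha \<epsilon>(1) \<delta>, where ?x1.0 = "avg M J f" and ?x2.0 = "avg M J (\<lambda>x. (f x)\<^sup>2)"])
        (auto simp: var_def)
  qed simp
  finally show ?thesis .
next
  case False
  have \<delta>0: "0 < \<delta>" using \<delta> \<epsilon>(1) alpha by simp
  have "node \<delta> f J = \<bar>avg M J f\<bar>"
  proof (cases "\<bar>avg M J f\<bar> \<le> \<delta>")
    case True
    then have "avg M J (\<lambda>x. (f x)\<^sup>2) / (2 * \<delta>) \<le> \<bar>avg M J f\<bar>"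
      using False \<delta>0 by (simp add: divide_le_eq mult.commute)
    then show ?thesis by (simp add: bellman_def max_absorb1)
  qed (simp add: bellman_def)
  then have "measure M J * node \<delta> f J = \<bar>\<Sum>I\<in>C J. measure M I * avg M I f\<bar>"
    using sum_children_avg[OF J f(1)] by (simp add: abs_mult)
  also have "\<dots> \<le> (\<Sum>I\<in>C J. measure M I * \<bar>avg M I f\<bar>)"
    using sum_abs[of "\<lambda>I. measure M I * avg M I f" "C J"] by (simp add: abs_mult)
  also have "\<dots> \<le> (\<Sum>I\<in>C J. measure M I * node \<delta> f I)"
    by (intro sum_mono mult_left_mono bellman_ge_abs) simp
  finally show ?thesis .
qed

lemma bellman_le_level:
  assumes J: "J \<in> T" and f: "integrable M f" "integrable M (\<lambda>x. (f x)\<^sup>2)"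
    and \<epsilon>: "0 < \<epsilon>" "\<And>I. I \<in> T \<Longrightarrow> var M I f \<le> \<epsilon>\<^sup>2"
    and \<delta>: "\<delta> = (1 + \<alpha>) * \<epsilon> / (2 * sqrt \<alpha>)"
  shows "measure M J * node \<delta> f J \<le> (\<Sum>I\<in>level J m. measure M I * node \<delta> f I)"
proof (induction m)
  case (Suc m)
  note Suc
  also have "(\<Sum>I\<in>level J m. measure M I * node \<delta> f I)
      \<le> (\<Sum>K\<in>level J m. \<Sum>I\<in>C K. measure M I * node \<delta> f I)"
    using level_T[OF J] by (intro sum_mono bellman_le_children[OF _ f \<epsilon> \<delta>]) auto
  also have "\<dots> = (\<Sum>I\<in>level J (Suc m). measure M I * node \<delta> f I)"
    by (rule sum_level_Suc[OF J, symmetric])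
  finally show ?case .
qed simp

text \<open>\<open>bellman\<close> at \<open>J\<close> is compared with its mean over generation
  \<open>m\<close>, which exceeds the mean of \<open>\<bar>f\<bar>\<close> by at most a multiple of
  the total variance of that generation; then \<open>m\<close> tends to infinity.\<close>

lemma avg_sq_le_avg_abs:
  assumes J: "J \<in> T" and f: "integrable M f" "integrable M (\<lambda>x. (f x)\<^sup>2)"
    and \<epsilon>: "0 < \<epsilon>" "\<And>I. I \<in> T \<Longrightarrow> var M I f \<le> \<epsilon>\<^sup>2"
    and mean: "avg M J f = 0"
  shows "sqrt \<alpha> / ((1 + \<alpha>) * \<epsilon>) * avg M J (\<lambda>x. (f x)\<^sup>2) \<le> avg M J (\<lambda>x. \<bar>f x\<bar>)"
proof -
  define \<delta> where "\<delta> = (1 + \<alpha>) * \<epsilon> / (2 * sqrt \<alpha>)"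
  have \<delta>0: "0 < \<delta>" using \<epsilon>(1) alpha by (simp add: \<delta>_def)
  have "measure M J * node \<delta> f J \<le> measure M J * avg M J (\<lambda>x. \<bar>f x\<bar>)
      + (\<Sum>I\<in>level J m. measure M I * var M I f) / (2 * \<delta>)" for m
  proof -
    have "measure M J * node \<delta> f J \<le> (\<Sum>I\<in>level J m. measure M I * node \<delta> f I)"
      by (rule bellman_le_level[OF J f \<epsilon> \<delta>_def])
    also have "\<dots> \<le> (\<Sum>I\<in>level J m. measure M I * (avg M I (\<lambda>x. \<bar>f x\<bar>) + var M I f / (2 * \<delta>)))"
    proof (intro sum_mono mult_left_mono)
      fix I assume "I \<in> level J m"
      then have "I \<in> T" using level_T[OF J] by auto
      then have "0 \<le> var M I f" using T_sets measure_pos by (intro var_nonneg f) auto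
      then have "node \<delta> f I \<le> \<bar>avg M I f\<bar> + var M I f / (2 * \<delta>)"
        using bellman_le[OF \<delta>0] by (simp add: var_def)
      then show "node \<delta> f I \<le> avg M I (\<lambda>x. \<bar>f x\<bar>) + var M I f / (2 * \<delta>)"
        using abs_avg_le[of I f] by linarith
    qed simp
    also have "\<dots> = measure M J * avg M J (\<lambda>x. \<bar>f x\<bar>) + (\<Sum>I\<in>level J m. measure M I * var M I f) / (2 * \<delta>)"
      using f(1) by (simp add: distrib_left sum.distrib sum_level_avg[OF J] sum_divide_distrib)
    finally show ?thesis .
  qed
  moreover have "(\<lambda>m. measure M J * avg M J (\<lambda>x. \<bar>f x\<bar>)
      + (\<Sum>I\<in>level J m. measure M I * var M I f) / (2 * \<delta>))
      \<longlonglongrightarrow> measure M J * avg M J (\<lambda>x. \<bar>f x\<bar>) + 0 / (2 * \<delta>)"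
    using \<delta>0 by (intro tendsto_intros sum_level_var_tendsto_0[OF J f \<epsilon>(2)]) auto
  ultimately have "measure M J * node \<delta> f J \<le> measure M J * avg M J (\<lambda>x. \<bar>f x\<bar>) + 0 / (2 * \<delta>)"
    by (intro LIMSEQ_le_const) auto
  then have "node \<delta> f J \<le> avg M J (\<lambda>x. \<bar>f x\<bar>)"
    using measure_pos[OF J] by simp
  \<comment> \<open>Mean zero puts the point of \<open>J\<close> on the axis of the angle, where the
    linear branch of \<open>bellman\<close> is available.\<close>
  moreover have "avg M J (\<lambda>x. (f x)\<^sup>2) / (2 * \<delta>) \<le> node \<delta> f J"
    using \<delta>0 by (simp add: bellman_def mean)
  ultimately have "avg M J (\<lambda>x. (f x)\<^sup>2) / (2 * \<delta>) \<le> avg M J (\<lambda>x. \<bar>f x\<bar>)"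
    by linarith
  moreover have "sqrt \<alpha> / ((1 + \<alpha>) * \<epsilon>) * y = y / (2 * \<delta>)" for y
    by (simp add: \<delta>_def mult.commute)
  ultimately show ?thesis by simp
qed

section \<open>Oscillations and the two norms\<close>

lemma osc_1_eq: "osc 1 M J f = avg M J (\<lambda>x. \<bar>f x - avg M J f\<bar>)"
  by (simp add: osc_def)

lemma osc_2_eq:
  assumes "J \<in> T" "integrable M f" "integrable M (\<lambda>x. (f x)\<^sup>2)"
  shows "osc 2 M J f = var M J f"
proof -
  have "osc 2 M J f = avg M J (\<lambda>x. (f x - avg M J f)\<^sup>2)"
    by (simp add: osc_def)
  also have "\<dots> = var M J f"
    using assms T_sets measure_pos by (subst avg_sq_diff_const) auto
  finally show ?thesis .
qed

text \<open>Subtracting the mean over \<open>J\<close> reduces to mean zero on \<open>J\<close>. The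
  variances on all nodes are unchanged, so the bound by \<epsilon> squared survives.\<close>

lemma osc_2_le_osc_1:
  assumes J: "J \<in> T" and f: "integrable M f" "integrable M (\<lambda>x. (f x)\<^sup>2)"
    and \<epsilon>: "0 < \<epsilon>" "\<And>I. I \<in> T \<Longrightarrow> var M I f \<le> \<epsilon>\<^sup>2"
  shows "sqrt \<alpha> / ((1 + \<alpha>) * \<epsilon>) * osc 2 M J f \<le> osc 1 M J f"
proof -
  define g where "g x = f x - avg M J f" for x
  have JM: "J \<in> sets M" "0 < measure M J" using J T_sets measure_pos by auto
  have g: "integrable M g" "integrable M (\<lambda>x. (g x)\<^sup>2)" "avg M J g = 0"
    unfolding g_def using f JM integrable_sq_diff_const avg_diff_const by auto
  have "var M I g \<le> \<epsilon>\<^sup>2" if "I \<in> T" for I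
    unfolding g_def using that T_sets measure_pos by (subst var_diff_const) (auto intro: f \<epsilon>)
  then have "sqrt \<alpha> / ((1 + \<alpha>) * \<epsilon>) * avg M J (\<lambda>x. (g x)\<^sup>2) \<le> avg M J (\<lambda>x. \<bar>g x\<bar>)"
    by (intro avg_sq_le_avg_abs J g \<epsilon>(1))
  moreover have "avg M J (\<lambda>x. (g x)\<^sup>2) = osc 2 M J f"
    unfolding g_def osc_2_eq[OF J f] avg_sq_diff_const[OF f JM] by simp
  ultimately show ?thesis by (simp add: osc_1_eq g_def)
qed

lemma BMO_integrable:
  assumes "\<phi> \<in> BMO M T"
  shows "integrable M \<phi>" "integrable M (\<lambda>x. (\<phi> x)\<^sup>2)"
  using assms by (auto simp: BMO_def intro: square_integrable_imp_integrable)

lemma BMO_norm_var: "BMO_norm M T f = (SUP J\<in>T. ereal (sqrt (var M J f)))"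
  by (simp add: BMO_norm_def var_def)

lemma var_le_of_BMO_norm_le:
  assumes "BMO_norm M T f \<le> ereal \<epsilon>" "I \<in> T"
  shows "var M I f \<le> \<epsilon>\<^sup>2"
  using assms by (auto simp: BMO_norm_var SUP_le_iff intro: sqrt_le_D)

text \<open>The local inequality is used with \<epsilon> equal to the norm \<open>N\<close> itself.
  It bounds every variance by \<open>r * N / k\<close>, where \<open>r\<close> is the other norm;
  the supremum gives \<open>N\<^sup>2 \<le> r * N / k\<close>, and one factor \<open>N\<close>
  cancels.\<close>

lemma BMO_norm_le_BMO1_norm:
  assumes \<phi>: "\<phi> \<in> BMO M T"
  shows "ereal (sqrt \<alpha> / (1 + \<alpha>)) * BMO_norm M T \<phi> \<le> BMO1_norm M T \<phi>"
proof -
  define k where "k = sqrt \<alpha> / (1 + \<alpha>)"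
  have k: "0 < k" using alpha by (simp add: k_def)
  have osc1_nonneg: "0 \<le> osc 1 M J \<phi>" for J
    by (simp add: osc_1_eq avg_def set_lebesgue_integral_def)
  \<comment> \<open>The root is a member of the tree, so the suprema run over a nonempty family and
    are nonnegative. With finiteness from \<open>BMO\<close> this makes the first norm a real
    number.\<close>
  have "0 \<le> ereal (sqrt (var M (space M) \<phi>))"
    using var_nonneg[OF BMO_integrable[OF \<phi>] sets.top space_pos] by simp
  also have "\<dots> \<le> BMO_norm M T \<phi>" unfolding BMO_norm_var by (rule SUP_upper[OF space_T])
  finally have "0 \<le> BMO_norm M T \<phi>" .
  moreover have "BMO_norm M T \<phi> < \<infinity>" using \<phi> by (simp add: BMO_def)
  ultimately obtain N where N: "BMO_norm M T \<phi> = ereal N" "0 \<le> N"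
    by (cases "BMO_norm M T \<phi>") auto
  have "0 \<le> ereal (osc 1 M (space M) \<phi>)" using osc1_nonneg by simp
  also have "\<dots> \<le> BMO1_norm M T \<phi>" unfolding BMO1_norm_def by (rule SUP_upper[OF space_T])
  finally have BMO1_nonneg: "0 \<le> BMO1_norm M T \<phi>" .
  have "ereal (k * N) \<le> BMO1_norm M T \<phi>"
  proof (cases "BMO1_norm M T \<phi>")
    case (real r)
    show ?thesis
    \<comment> \<open>The local inequality needs a positive \<epsilon>, so the norm 0 is treated
      apart.\<close>
    proof (cases "N = 0")
      case False
      then have N0: "0 < N" using N by simp
      have "sqrt (var M J \<phi>) \<le> sqrt (r * N / k)" if J: "J \<in> T" for J
      proof -
        have "k / N * var M J \<phi> \<le> osc 1 M J \<phi>"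
          using osc_2_le_osc_1[OF J BMO_integrable[OF \<phi>] N0] var_le_of_BMO_norm_le N(1)
          by (simp add: osc_2_eq[OF J BMO_integrable[OF \<phi>]] k_def)
        also have "osc 1 M J \<phi> \<le> r"
          using real SUP_upper[OF J, of "\<lambda>J. ereal (osc 1 M J \<phi>)"] by (simp add: BMO1_norm_def)
        finally show ?thesis using k N0 by (simp add: field_simps)
      qed
      then have "BMO_norm M T \<phi> \<le> ereal (sqrt (r * N / k))"
        unfolding BMO_norm_var by (intro SUP_least) simp
      then have "N \<le> sqrt (r * N / k)" using N by simp
      then have "N\<^sup>2 \<le> r * N / k"
        using power_mono[OF _ N(2), of "sqrt (r * N / k)" 2] real BMO1_nonneg N(2) k by simp
      then have "k * N \<le> r" using N0 k by (simp add: power2_eq_square field_simps)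
      then show ?thesis using real by simp
    qed (use BMO1_nonneg in \<open>simp add: zero_ereal_def\<close>)
  qed (use BMO1_nonneg in auto)
  then show ?thesis using N by (simp add: k_def)
qed

end

theorem theorem1p8:
  fixes M :: "'a measure" and \<alpha> :: real and T :: "'a set set"
  assumes "0 < emeasure M (space M)" and "emeasure M (space M) < \<infinity>"
    and "0 < \<alpha>" and "\<alpha> \<le> 1 / 2"
    and "alpha_tree M \<alpha> T"
  shows "(\<forall>\<epsilon>::real. \<epsilon> > 0 \<longrightarrow> (\<forall>\<phi>\<in>BMO M T. BMO_norm M T \<phi> \<le> ereal \<epsilon> \<longrightarrow>
            (\<forall>J\<in>T. sqrt \<alpha> / ((1 + \<alpha>) * \<epsilon>) * osc 2 M J \<phi> \<le> osc 1 M J \<phi>))) \<and>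
         (\<forall>\<phi>\<in>BMO M T. ereal (sqrt \<alpha> / (1 + \<alpha>)) * BMO_norm M T \<phi> \<le> BMO1_norm M T \<phi>)"
proof -
  interpret finite_measure M using assms(2) by (intro finite_measureI) auto
  note tree = assms(5)[unfolded alpha_tree_def]
  \<comment> \<open>One children map is fixed here, and all generations refer to it.\<close>
  obtain C where C: "\<forall>J\<in>T. C J \<subseteq> T \<and> J = \<Union>(C J) \<and>
              pairwise (\<lambda>I I'. I \<inter> I' \<in> null_sets M) (C J) \<and>
              (\<forall>I\<in>C J. measure M I \<ge> \<alpha> * measure M J)"
    and levels: "T = (\<Union>m. tree_level (space M) C m)"
    and diff: "\<forall>f :: 'a \<Rightarrow> real. integrable M f \<longrightarrow>
             (AE x in M. \<forall>S. (\<forall>m. S m \<in> tree_level (space M) C m \<and> x \<in> S m) \<longrightarrow>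
                (\<lambda>m. avg M (S m) f) \<longlonglongrightarrow> f x)"
    using tree[THEN conjunct2, THEN conjunct2]
    by (elim exE conjE) (rule that; assumption)
  interpret measure_tree M \<alpha> T C
  proof
    show "0 < measure M (space M)" using assms(1) by (simp add: emeasure_eq_measure)
    show "0 < \<alpha>" "\<alpha> < 1" using assms(3,4) by simp_all
    show "T \<subseteq> sets M" by (rule tree[THEN conjunct1])
    show "space M \<in> T" by (rule tree[THEN conjunct2, THEN conjunct1])
    show "T = (\<Union>m. tree_level (space M) C m)" by (fact levels)
    fix J assume J: "J \<in> T"
    note CJ = bspec[OF C J]
    show "C J \<subseteq> T" by (rule CJ[THEN conjunct1])
    show "\<Union>(C J) = J" by (rule CJ[THEN conjunct2, THEN conjunct1, symmetric])
    show "pairwise (\<lambda>I I'. I \<inter> I' \<in> null_sets M) (C J)"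
      by (rule CJ[THEN conjunct2, THEN conjunct2, THEN conjunct1])
    show "\<alpha> * measure M J \<le> measure M I" if "I \<in> C J" for I
      by (rule CJ[THEN conjunct2, THEN conjunct2, THEN conjunct2, rule_format, OF that])
  next
    fix f :: "'a \<Rightarrow> real" assume "integrable M f"
    then show "AE x in M. \<forall>S. (\<forall>m. S m \<in> tree_level (space M) C m \<and> x \<in> S m) \<longrightarrow>
        (\<lambda>m. avg M (S m) f) \<longlonglongrightarrow> f x"
      using diff by simp
  qed
  show ?thesis
  proof (intro conjI allI impI ballI)
    fix \<epsilon> :: real and \<phi> J
    assume "0 < \<epsilon>" "\<phi> \<in> BMO M T" "BMO_norm M T \<phi> \<le> ereal \<epsilon>" "J \<in> T"
    then show "sqrt \<alpha> / ((1 + \<alpha>) * \<epsilon>) * osc 2 M J \<phi> \<le> osc 1 M J \<phi>"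
      by (intro osc_2_le_osc_1 BMO_integrable var_le_of_BMO_norm_le)
  qed (rule BMO_norm_le_BMO1_norm)
qed

end
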